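(* Suppose we have multi-patterns $\tau=\tau_1\text{-}\tau_2\text{-}\cdots\text{-}\tau_s$ and $\phi=\phi_1\text{-}\phi_2\text{-}\cdots\text{-}\phi_s$, where the sequence of blocks $\tau_1,\tau_2,\ldots,\tau_s$ is a permutation of the sequence of blocks $\phi_1,\phi_2,\ldots,\phi_s$. Then $\tau\equiv\phi$.
   Context: A composition $\sigma=\sigma_1\ldots\sigma_m$ of $n$ with $m$ parts in a finite set $A$ of positive integers is a sequence of $m$ elements of $A$ with sum $n$; the set of these is $C_{n;m}^A$. A partially ordered pattern (POP) is a word $\rho_1\ldots\rho_r$ of letters from a partially ordered alphabet (repeated letters allowed), possibly with dashes between some neighbouring letters. An occurrence of $\rho$ in $\sigma$ is a choice of positions $i_1<\cdots<i_r$ such that: $i_{p+1}=i_p+1$ whenever there is no dash between $\rho_p$ and $\rho_{p+1}$; $\sigma_{i_p}=\sigma_{i_q}$ whenever $\rho_p=\rho_q$; and $\sigma_{i_p}<\sigma_{i_q}$ whenever $\rho_p<\rho_q$. Nothing is required for incomparable letters. $\sigma$ avoids $\rho$ if it has no occurrence of $\rho$. Two POPs are equivalent, $\tau\equiv\phi$, if for every finite set $A$ of positive integers and all $n,m$ the number of compositions in $C_{n;m}^A$ that avoid $\tau$ equals the number that avoid $\phi$. A consecutive pattern is a dash-free word over a totally ordered alphabet $[t]=\{1,\dots,t\}$ that contains each letter of $[t]$ at least once. A multi-pattern $\tau_1\text{-}\tau_2\text{-}\cdots\text{-}\tau_s$ is the POP obtained from consecutive patterns $\tau_1,\dots,\tau_s$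 (not necessarily distinct) by concatenating them with dashes exactly between successive blocks, where each letter of the block $\tau_i$ is incomparable with every letter of the block $\tau_j$ whenever $i\neq j$ (the blocks use disjoint copies of their alphabets, and the order inside each block is kept). *)

theory Defs
  imports Main "HOL-Combinatorics.List_Permutation"
begin

definition compositions :: "nat set \<Rightarrow> nat \<Rightarrow> nat \<Rightarrow> nat list set" where
  "compositions A n m = {\<sigma>. set \<sigma> \<subseteq> A \<and> length \<sigma> = m \<and> sum_list \<sigma> = n}"

text \<open>
  Letters are numbered from 0, and \<open>p \<in> dashes \<rho>\<close> means that there is a dash between the
  letters number \<open>p\<close> and \<open>Suc p\<close>. The field \<open>prec\<close> is the strict order of the alphabet.
\<close>
record 'a pop =
  word :: "'a list"
  prec :: "'a \<Rightarrow> 'a \<Rightarrow> bool"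
  dashes :: "nat set"

definition is_pop :: "'a pop \<Rightarrow> bool" where
  "is_pop \<rho> \<longleftrightarrow> irreflp (prec \<rho>) \<and> transp (prec \<rho>) \<and>
     (\<forall>p\<in>dashes \<rho>. Suc p < length (word \<rho>))"

definition is_occurrence :: "'a pop \<Rightarrow> nat list \<Rightarrow> nat list \<Rightarrow> bool" where
  "is_occurrence \<rho> \<sigma> is \<longleftrightarrow>
     length is = length (word \<rho>) \<and>
     sorted_wrt (<) is \<and>
     (\<forall>i\<in>set is. i < length \<sigma>) \<and>
     (\<forall>p. Suc p < length (word \<rho>) \<and> p \<notin> dashes \<rho> \<longrightarrow> is ! Suc p = Suc (is ! p)) \<and>
     (\<forall>p < length (word \<rho>). \<forall>q < length (word \<rho>).
        (word \<rho> ! p = word \<rho> ! q \<longrightarrow> \<sigma> ! (is ! p) = \<sigma> ! (is ! q)) \<and>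
        (prec \<rho> (word \<rho> ! p) (word \<rho> ! q) \<longrightarrow> \<sigma> ! (is ! p) < \<sigma> ! (is ! q)))"

definition avoids :: "nat list \<Rightarrow> 'a pop \<Rightarrow> bool" where
  "avoids \<sigma> \<rho> \<longleftrightarrow> (\<nexists>is. is_occurrence \<rho> \<sigma> is)"

definition pop_equiv :: "'a pop \<Rightarrow> 'b pop \<Rightarrow> bool" where
  "pop_equiv \<tau> \<phi> \<longleftrightarrow>
     (\<forall>A n m. finite A \<and> (\<forall>a\<in>A. 0 < a) \<longrightarrow>
        card {\<sigma> \<in> compositions A n m. avoids \<sigma> \<tau>} =
        card {\<sigma> \<in> compositions A n m. avoids \<sigma> \<phi>})"

text \<open>The condition \<open>1 \<le> t\<close> excludes the empty word, next to which a dash makes no sense.\<close>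
definition consecutive_pattern :: "nat list \<Rightarrow> bool" where
  "consecutive_pattern w \<longleftrightarrow> (\<exists>t\<ge>1. set w = {1..t})"

text \<open>
  The letter \<open>a\<close> of block number \<open>i\<close> is encoded as \<open>(i, a)\<close>, so that different blocks have
  disjoint and mutually incomparable alphabets, even when the blocks are equal as words. The last
  letter of each block except the final one is followed by a dash.
\<close>
definition multi_pattern :: "nat list list \<Rightarrow> (nat \<times> nat) pop" where
  "multi_pattern ws =
     \<lparr>word = concat (map (\<lambda>i. map (Pair i) (ws ! i)) [0..<length ws]),
      prec = (\<lambda>(i, a) (j, b). i = j \<and> a < b),
      dashes = {p. \<exists>k. 0 < k \<and> k < length ws \<and> Suc p = length (concat (take k ws))}\<rparr>"

lemma finite_compositions: "finite A \<Longrightarrow> finite (compositions A n m)"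
  by (rule finite_subset[OF _ finite_lists_length_eq[of A m]]) (auto simp: compositions_def)

lemma length_word_multi_pattern: "length (word (multi_pattern ws)) = length (concat ws)"
proof -
  have "map length ws = map (\<lambda>i. length (ws ! i)) [0..<length ws]"
    by (rule nth_equalityI) auto
  then show ?thesis
    by (simp add: multi_pattern_def length_concat comp_def)
qed

lemma is_pop_multi_pattern:
  assumes "\<forall>w\<in>set ws. consecutive_pattern w"
  shows "is_pop (multi_pattern ws)"
proof -
  have "length (concat (take k ws)) < length (concat ws)" if k: "k < length ws" for k
  proof -
    have "ws ! k \<noteq> []"
      using assms k nth_mem[OF k] by (fastforce simp: consecutive_pattern_def)
    moreover have "concat ws = concat (take k ws) @ ws ! k @ concat (drop (Suc k) ws)"
      by (metis id_take_nth_drop[OF k] concat.simps(2) concat_append)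
    ultimately show ?thesis
      by (metis length_append length_greater_0_conv less_add_same_cancel1 add_gr_0)
  qed
  then have "\<forall>p\<in>dashes (multi_pattern ws). Suc p < length (word (multi_pattern ws))"
    by (auto simp: length_word_multi_pattern) (auto simp: multi_pattern_def)
  moreover have "irreflp (prec (multi_pattern ws))" "transp (prec (multi_pattern ws))"
    by (auto simp: multi_pattern_def irreflp_def transp_def)
  ultimately show ?thesis
    by (simp add: is_pop_def)
qed

end

theory Submission
  imports Defs
begin

text \<open>
  The blocks of a multi-pattern are mutually incomparable and separated by dashes, so a word
  contains \<open>\<tau>\<^sub>1-\<dots>-\<tau>\<^sub>s\<close> exactly when it can be cut into consecutive pieces of which the
  \<open>i\<close>-th contains \<open>\<tau>\<^sub>i\<close> (\<open>ex_occurrence_iff\<close>). Cutting greedily, as soon as the current block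
  has occurred, makes the decomposition unique: a containing word factors uniquely as
  \<open>p\<^sub>1 \<dots> p\<^sub>s v\<close>, where \<open>p\<^sub>i\<close> contains \<open>\<tau>\<^sub>i\<close>, no proper prefix of \<open>p\<^sub>i\<close> does, and \<open>v\<close> is arbitrary
  (\<open>contains_blocks_Cons\<close>, \<open>prefix_free_first_matches\<close>). The factors can now be permuted along with
  the blocks. This is a bijection between the words containing \<open>\<tau>\<close> and those containing \<open>\<phi>\<close>
  (\<open>rearranges_to_contains_blocks\<close>), and it only rearranges letters, so it preserves the
  multiset of parts, in particular their number and their sum. Hence equally many compositions
  contain \<open>\<tau>\<close> and \<open>\<phi>\<close>, and by taking complements equally many avoid them.
\<close>

section \<open>Rearranging the factors of a product of languages\<close>

definition conc :: "'a list set \<Rightarrow> 'a list set \<Rightarrow> 'a list set" (infixr \<open>\<cdot>\<close> 75) where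
  "X \<cdot> Y = {x @ y | x y. x \<in> X \<and> y \<in> Y}"

definition prefix_free :: "'a list set \<Rightarrow> bool" where
  "prefix_free P \<longleftrightarrow> (\<forall>p r. p \<in> P \<longrightarrow> p @ r \<in> P \<longrightarrow> r = [])"

definition rearranges_to :: "'a list set \<Rightarrow> 'a list set \<Rightarrow> bool" where
  "rearranges_to X Y \<longleftrightarrow> (\<exists>f. bij_betw f X Y \<and> (\<forall>x\<in>X. mset (f x) = mset x))"

lemma rearranges_to_refl: "rearranges_to X X"
  unfolding rearranges_to_def by (rule exI[of _ id]) auto

lemma rearranges_to_trans:
  assumes "rearranges_to X Y" "rearranges_to Y Z"
  shows "rearranges_to X Z"
proof -
  from assms obtain f g where f: "bij_betw f X Y" "\<forall>x\<in>X. mset (f x) = mset x"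
    and g: "bij_betw g Y Z" "\<forall>y\<in>Y. mset (g y) = mset y"
    unfolding rearranges_to_def by blast
  have "\<forall>x\<in>X. mset ((g \<circ> f) x) = mset x"
    using f g by (simp add: bij_betw_apply)
  then show ?thesis
    unfolding rearranges_to_def using bij_betw_trans[OF f(1) g(1)] by blast
qed

lemma append_eq_append_prefix_free:
  assumes "prefix_free P" "p \<in> P" "p' \<in> P" "p @ x = p' @ x'"
  shows "p = p' \<and> x = x'"
  using assms by (auto simp: append_eq_append_conv2 prefix_free_def)

text \<open>
  A bijection between index sets transfers to the languages they parametrise; below, the indices
  are the tuples of factors of a unique factorisation.
\<close>
lemma rearranges_to_transfer:
  assumes f: "bij_betw f I X" and g: "bij_betw g J Y" and h: "bij_betw h I J"
    and mset_eq: "\<And>i. i \<in> I \<Longrightarrow> mset (g (h i)) = mset (f i)"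
  shows "rearranges_to X Y"
  unfolding rearranges_to_def
proof (intro exI conjI ballI)
  show "bij_betw (g \<circ> h \<circ> inv_into I f) X Y"
    using f g h by (meson bij_betw_trans bij_betw_inv_into)
  fix x assume "x \<in> X"
  then have "inv_into I f x \<in> I" "f (inv_into I f x) = x"
    using f by (auto simp: bij_betw_def intro: inv_into_into f_inv_into_f)
  then show "mset ((g \<circ> h \<circ> inv_into I f) x) = mset x"
    by (simp add: mset_eq)
qed

lemma bij_betw_conc:
  assumes "prefix_free P"
  shows "bij_betw (\<lambda>(p, x). p @ x) (P \<times> X) (P \<cdot> X)"
  unfolding bij_betw_def
proof
  show "inj_on (\<lambda>(p, x). p @ x) (P \<times> X)"
    by (auto simp: inj_on_def dest: append_eq_append_prefix_free[OF assms])
  show "(\<lambda>(p, x). p @ x) ` (P \<times> X) = P \<cdot> X"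
    by (auto simp: conc_def image_def)
qed

lemma bij_betw_conc_conc:
  assumes P: "prefix_free P" and Q: "prefix_free Q"
  shows "bij_betw (\<lambda>(p, q, x). p @ q @ x) (P \<times> Q \<times> X) (P \<cdot> Q \<cdot> X)"
proof -
  have "bij_betw (map_prod id (\<lambda>(q, x). q @ x)) (P \<times> Q \<times> X) (P \<times> (Q \<cdot> X))"
    by (intro bij_betw_map_prod bij_betw_conc Q) simp
  from bij_betw_trans[OF this bij_betw_conc[OF P]] show ?thesis
    by (rule bij_betw_cong[THEN iffD1, rotated]) auto
qed

lemma rearranges_to_conc_right:
  assumes "prefix_free P" "rearranges_to X Y"
  shows "rearranges_to (P \<cdot> X) (P \<cdot> Y)"
proof -
  from assms(2) obtain f where f: "bij_betw f X Y" "\<forall>x\<in>X. mset (f x) = mset x"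
    unfolding rearranges_to_def by blast
  show ?thesis
  proof (rule rearranges_to_transfer[OF bij_betw_conc[OF assms(1)] bij_betw_conc[OF assms(1)]])
    show "bij_betw (map_prod id f) (P \<times> X) (P \<times> Y)"
      by (intro bij_betw_map_prod f) simp
  qed (use f in auto)
qed

text \<open>
  Both products factor uniquely, so exchanging the first two factors is well defined and
  invertible.
\<close>
lemma rearranges_to_swap:
  assumes "prefix_free P" "prefix_free Q"
  shows "rearranges_to (P \<cdot> Q \<cdot> X) (Q \<cdot> P \<cdot> X)"
proof (rule rearranges_to_transfer[OF bij_betw_conc_conc[OF assms]
      bij_betw_conc_conc[OF assms(2) assms(1)]])
  show "bij_betw (\<lambda>(p, q, x). (q, p, x)) (P \<times> Q \<times> X) (Q \<times> P \<times> X)"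
    by (rule bij_betwI[of _ _ _ "\<lambda>(q, p, x). (p, q, x)"]) auto
qed auto

section \<open>Words containing a sequence of blocks\<close>

definition matches_block :: "nat list \<Rightarrow> nat list \<Rightarrow> bool" where
  "matches_block w y \<longleftrightarrow> length y = length w \<and>
     (\<forall>p<length w. \<forall>q<length w.
        (w ! p = w ! q \<longrightarrow> y ! p = y ! q) \<and> (w ! p < w ! q \<longrightarrow> y ! p < y ! q))"

definition contains_block :: "nat list \<Rightarrow> nat list \<Rightarrow> bool" where
  "contains_block w u \<longleftrightarrow> (\<exists>x y z. u = x @ y @ z \<and> matches_block w y)"

fun contains_blocks :: "nat list list \<Rightarrow> nat list set" where
  "contains_blocks [] = UNIV"
| "contains_blocks (w # ws) = Collect (contains_block w) \<cdot> contains_blocks ws"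

text \<open>What a left-to-right search for the block can have read at the moment it first succeeds.\<close>
definition first_matches :: "nat list \<Rightarrow> nat list set" where
  "first_matches w =
     {u. contains_block w u \<and> (\<forall>u' r. u = u' @ r \<longrightarrow> contains_block w u' \<longrightarrow> r = [])}"

lemma prefix_free_first_matches: "prefix_free (first_matches w)"
  by (auto simp: prefix_free_def first_matches_def)

lemma contains_block_append_left: "contains_block w u \<Longrightarrow> contains_block w (r @ u)"
  unfolding contains_block_def by (metis append.assoc)

lemma contains_blocks_append_left:
  "v \<in> contains_blocks ws \<Longrightarrow> r @ v \<in> contains_blocks ws"
proof (cases ws)
  case (Cons w ws')
  assume "v \<in> contains_blocks ws"
  then obtain u t where "v = u @ t" "contains_block w u" "t \<in> contains_blocks ws'"
    by (auto simp: Cons conc_def)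
  moreover from this have "contains_block w (r @ u)"
    by (simp add: contains_block_append_left)
  ultimately show ?thesis
    by (auto simp: Cons conc_def) (metis append.assoc)
qed simp

lemma contains_block_first_match:
  assumes "contains_block w u"
  shows "\<exists>p r. u = p @ r \<and> p \<in> first_matches w"
  using assms
proof (induction u rule: length_induct)
  case (1 u)
  show ?case
  proof (cases "u \<in> first_matches w")
    case False
    then obtain u' r where *: "u = u' @ r" "contains_block w u'" "r \<noteq> []"
      using 1(2) by (auto simp: first_matches_def)
    then have "length u' < length u" by simp
    then obtain p r' where "u' = p @ r'" "p \<in> first_matches w" using 1(1) * by blast
    then show ?thesis using * by auto
  qed auto
qed

text \<open>
  Cutting at the earliest possible place loses nothing, because the letters this leaves over
  are passed on to the next piece, and containment survives prepending letters.
\<close>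
lemma contains_blocks_Cons:
  "contains_blocks (w # ws) = first_matches w \<cdot> contains_blocks ws"
proof
  show "contains_blocks (w # ws) \<subseteq> first_matches w \<cdot> contains_blocks ws"
  proof
    fix v assume "v \<in> contains_blocks (w # ws)"
    then obtain u t where v: "v = u @ t" "contains_block w u" "t \<in> contains_blocks ws"
      by (auto simp: conc_def)
    from contains_block_first_match[OF v(2)] obtain p r where
      "u = p @ r" "p \<in> first_matches w" by blast
    then have "v = p @ (r @ t)" "r @ t \<in> contains_blocks ws" "p \<in> first_matches w"
      using v contains_blocks_append_left by auto
    then show "v \<in> first_matches w \<cdot> contains_blocks ws" unfolding conc_def by blast
  qed
  show "first_matches w \<cdot> contains_blocks ws \<subseteq> contains_blocks (w # ws)"
    by (auto simp: conc_def first_matches_def)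
qed

lemma rearranges_to_move_to_front:
  "w \<in> set ws \<Longrightarrow> rearranges_to (contains_blocks (w # remove1 w ws)) (contains_blocks ws)"
proof (induction ws)
  case (Cons a ws)
  show ?case
  proof (cases "a = w")
    case True
    then show ?thesis by (simp add: rearranges_to_refl)
  next
    case False
    then have "rearranges_to (contains_blocks (w # remove1 w ws)) (contains_blocks ws)"
      using Cons by simp
    then have "rearranges_to (contains_blocks (a # w # remove1 w ws)) (contains_blocks (a # ws))"
      unfolding contains_blocks_Cons[of a]
      by (intro rearranges_to_conc_right prefix_free_first_matches)
    moreover have "rearranges_to (contains_blocks (w # a # remove1 w ws))
        (contains_blocks (a # w # remove1 w ws))"
      unfolding contains_blocks_Cons
      by (intro rearranges_to_swap prefix_free_first_matches)
    ultimately show ?thesis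
      using False rearranges_to_trans by auto
  qed
qed simp

lemma rearranges_to_contains_blocks:
  "mset vs = mset ws \<Longrightarrow> rearranges_to (contains_blocks vs) (contains_blocks ws)"
proof (induction vs arbitrary: ws)
  case Nil
  then show ?case by (simp add: rearranges_to_refl)
next
  case (Cons v vs)
  have v: "v \<in> set ws"
    using Cons.prems by (metis list.set_intros(1) mset_eq_setD)
  have "mset vs = mset (remove1 v ws)"
    using Cons.prems by (metis mset_remove1 add_mset_remove_trivial mset.simps(2))
  then have "rearranges_to (contains_blocks (v # vs)) (contains_blocks (v # remove1 v ws))"
    unfolding contains_blocks_Cons
    by (intro rearranges_to_conc_right prefix_free_first_matches Cons.IH)
  then show ?case
    using rearranges_to_move_to_front[OF v] rearranges_to_trans by blast
qed

section \<open>Occurrences of a multi-pattern\<close>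

lemma word_multi_pattern_Cons:
  "word (multi_pattern (w # ws)) =
     map (Pair 0) w @ map (map_prod Suc id) (word (multi_pattern ws))"
proof -
  have "[0..<length (w # ws)] = 0 # map Suc [0..<length ws]"
    by (simp only: length_Cons upt_conv_Cons[OF zero_less_Suc] map_Suc_upt)
  then show ?thesis
    by (simp add: multi_pattern_def map_concat comp_def del: upt_Suc)
qed

lemma dashes_multi_pattern_Cons:
  assumes "w \<noteq> []"
  shows "p \<in> dashes (multi_pattern (w # ws)) \<longleftrightarrow>
    (Suc p = length w \<and> ws \<noteq> []) \<or>
    (length w \<le> p \<and> p - length w \<in> dashes (multi_pattern ws))"
    (is "?L \<longleftrightarrow> ?R")
proof
  assume ?L
  then obtain k where k: "0 < k" "k < Suc (length ws)" "Suc p = length (concat (take k (w # ws)))"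
    by (auto simp: multi_pattern_def)
  then obtain k' where k': "k = Suc k'" by (cases k) auto
  show ?R
  proof (cases k')
    case 0
    then show ?thesis using k k' by auto
  next
    case (Suc j)
    then have p: "Suc p = length w + length (concat (take k' ws))" using k k' by simp
    show ?thesis
    proof (cases "length w \<le> p")
      case True
      then show ?thesis
        using k k' Suc by (auto simp: multi_pattern_def intro!: exI[of _ k'])
    next
      case False
      then have "Suc p = length w" using p by linarith
      moreover have "ws \<noteq> []" using k k' Suc by auto
      ultimately show ?thesis by simp
    qed
  qed
next
  assume ?R
  then show ?L
  proof
    assume "Suc p = length w \<and> ws \<noteq> []"
    then show ?L by (auto simp: multi_pattern_def intro!: exI[of _ "Suc 0"])
  next
    assume *: "length w \<le> p \<and> p - length w \<in> dashes (multi_pattern ws)"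
    then obtain k where "0 < k" "k < length ws" "Suc (p - length w) = length (concat (take k ws))"
      by (auto simp: multi_pattern_def)
    then show ?L using * by (auto simp: multi_pattern_def intro!: exI[of _ "Suc k"])
  qed
qed

lemma prec_multi_pattern [simp]:
  "prec (multi_pattern ws) (i, a) (j, b) \<longleftrightarrow> i = j \<and> a < b"
  by (simp add: multi_pattern_def)

lemma prec_multi_pattern_Suc:
  "prec (multi_pattern (w # ws)) (map_prod Suc id x) (map_prod Suc id y) \<longleftrightarrow>
     prec (multi_pattern ws) x y"
  by (cases x; cases y) simp

lemma nth_word_multi_pattern_Cons:
  "p < length w \<Longrightarrow> word (multi_pattern (w # ws)) ! p = (0, w ! p)"
  "p < length (word (multi_pattern ws)) \<Longrightarrow>
     word (multi_pattern (w # ws)) ! (length w + p) = map_prod Suc id (word (multi_pattern ws) ! p)"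
  by (simp_all add: word_multi_pattern_Cons nth_append)

lemma map_prod_Suc_id_eq_iff [simp]: "map_prod Suc id x = map_prod Suc id y \<longleftrightarrow> x = y"
  by (cases x; cases y) simp

lemma length_word_multi_pattern_Cons:
  "length (word (multi_pattern (w # ws))) = length w + length (word (multi_pattern ws))"
  by (simp add: word_multi_pattern_Cons)

text \<open>
  Without dashes inside the first block, an occurrence places it on an interval of positions, and
  all later positions lie to the right of that interval. Cutting the word just after the interval
  thus separates the first block from an occurrence of the remaining ones, up to a shift.
\<close>
lemma is_occurrence_ConsD:
  assumes w: "w \<noteq> []" and occ: "is_occurrence (multi_pattern (w # ws)) \<sigma> is"
  shows "\<exists>u v is'. \<sigma> = u @ v \<and> contains_block w u \<and> is_occurrence (multi_pattern ws) v is'"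
proof -
  let ?\<rho> = "multi_pattern (w # ws)" and ?\<rho>' = "multi_pattern ws"
  let ?L = "length w"
  let ?W = "word (multi_pattern ws)"
  define a where "a = is ! 0"
  define c where "c = a + ?L"
  define is' where "is' = map (\<lambda>i. i - c) (drop ?L is)"
  have L: "0 < ?L" using w by simp
  have len: "length is = ?L + length ?W"
    using occ by (simp add: is_occurrence_def length_word_multi_pattern_Cons)
  have sorted: "is ! p < is ! q" if "p < q" "q < length is" for p q
    using occ that by (simp add: is_occurrence_def sorted_wrt_nth_less)
  have bound: "is ! p < length \<sigma>" if "p < length is" for p
    using occ that by (simp add: is_occurrence_def)
  have step: "is ! Suc p = Suc (is ! p)" if "Suc p < length is" "p \<notin> dashes ?\<rho>" for p
    using occ that by (simp add: is_occurrence_def)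
  have order: "(word ?\<rho> ! p = word ?\<rho> ! q \<longrightarrow> \<sigma> ! (is ! p) = \<sigma> ! (is ! q)) \<and>
      (prec ?\<rho> (word ?\<rho> ! p) (word ?\<rho> ! q) \<longrightarrow> \<sigma> ! (is ! p) < \<sigma> ! (is ! q))"
    if "p < length is" "q < length is" for p q
    using occ that unfolding is_occurrence_def by metis
  have first: "is ! p = a + p" if "p < ?L" for p
    using that
  proof (induction p)
    case (Suc p)
    then have "p \<notin> dashes ?\<rho>" by (simp add: dashes_multi_pattern_Cons[OF w])
    then show ?case using Suc step len by simp
  qed (simp add: a_def)
  have last: "is ! (?L - 1) = a + (?L - 1)" using L by (intro first) simp
  have c: "c \<le> length \<sigma>"
  proof -
    have "is ! (?L - 1) < length \<sigma>" by (intro bound) (use L len in linarith)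
    then show ?thesis using L last unfolding c_def by linarith
  qed
  have rest: "c \<le> is ! (?L + p)" if "p < length ?W" for p
  proof -
    have "is ! (?L - 1) < is ! (?L + p)" by (intro sorted) (use L len that in linarith)+
    then show ?thesis using L last unfolding c_def by linarith
  qed
  have is': "is' ! p = is ! (?L + p) - c" "drop c \<sigma> ! (is' ! p) = \<sigma> ! (is ! (?L + p))"
    if "p < length ?W" for p
    using that rest[OF that] c len by (simp_all add: is'_def)
  have "matches_block w (take ?L (drop a \<sigma>))"
    unfolding matches_block_def
  proof (intro conjI allI impI)
    show "length (take ?L (drop a \<sigma>)) = ?L" using c by (simp add: c_def)
  next
    fix p q assume "p < ?L" "q < ?L" "w ! p = w ! q"
    then show "take ?L (drop a \<sigma>) ! p = take ?L (drop a \<sigma>) ! q"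
      using order[of p q] c len first by (simp add: c_def nth_word_multi_pattern_Cons)
  next
    fix p q assume "p < ?L" "q < ?L" "w ! p < w ! q"
    then show "take ?L (drop a \<sigma>) ! p < take ?L (drop a \<sigma>) ! q"
      using order[of p q] c len first by (simp add: c_def nth_word_multi_pattern_Cons)
  qed
  moreover have "take c \<sigma> = take a \<sigma> @ take ?L (drop a \<sigma>) @ []"
    by (simp add: c_def take_add)
  ultimately have "contains_block w (take c \<sigma>)"
    unfolding contains_block_def by blast
  moreover have "is_occurrence ?\<rho>' (drop c \<sigma>) is'"
    unfolding is_occurrence_def
  proof (intro conjI)
    show len': "length is' = length ?W" by (simp add: is'_def len)
    show "sorted_wrt (<) is'"
      unfolding sorted_wrt_iff_nth_less
    proof (intro allI impI)
      fix p q assume "p < q" "q < length is'"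
      then show "is' ! p < is' ! q"
        using len' len is'(1)[of p] is'(1)[of q] rest[of p] rest[of q] sorted[of "?L + p" "?L + q"]
        by simp
    qed
    show "\<forall>i\<in>set is'. i < length (drop c \<sigma>)"
    proof
      fix i assume "i \<in> set is'"
      then obtain p where "p < length ?W" "i = is' ! p"
        by (metis in_set_conv_nth len')
      then show "i < length (drop c \<sigma>)"
        using is'(1)[of p] rest[of p] bound[of "?L + p"] len by simp
    qed
    show "\<forall>p. Suc p < length ?W \<and> p \<notin> dashes ?\<rho>' \<longrightarrow> is' ! Suc p = Suc (is' ! p)"
    proof (intro allI impI)
      fix p assume p: "Suc p < length ?W \<and> p \<notin> dashes ?\<rho>'"
      then have "?L + p \<notin> dashes ?\<rho>" by (simp add: dashes_multi_pattern_Cons[OF w])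
      then show "is' ! Suc p = Suc (is' ! p)"
        using p step[of "?L + p"] len is'(1)[of p] is'(1)[of "Suc p"] rest[of p] by simp
    qed
    show "\<forall>p<length ?W. \<forall>q<length ?W.
        (?W ! p = ?W ! q \<longrightarrow> drop c \<sigma> ! (is' ! p) = drop c \<sigma> ! (is' ! q)) \<and>
        (prec ?\<rho>' (?W ! p) (?W ! q) \<longrightarrow> drop c \<sigma> ! (is' ! p) < drop c \<sigma> ! (is' ! q))"
    proof (intro allI impI)
      fix p q assume "p < length ?W" "q < length ?W"
      then show "(?W ! p = ?W ! q \<longrightarrow> drop c \<sigma> ! (is' ! p) = drop c \<sigma> ! (is' ! q)) \<and>
        (prec ?\<rho>' (?W ! p) (?W ! q) \<longrightarrow> drop c \<sigma> ! (is' ! p) < drop c \<sigma> ! (is' ! q))"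
        using order[of "?L + p" "?L + q"] len
        by (simp add: is'(2) nth_word_multi_pattern_Cons prec_multi_pattern_Suc)
    qed
  qed
  ultimately show ?thesis
    by (metis append_take_drop_id)
qed

text \<open>
  Occurrences on the two sides of a cut combine freely: the dash between the blocks allows any gap,
  and no comparison is required across the cut.
\<close>
lemma is_occurrence_ConsI:
  assumes w: "w \<noteq> []" and u: "contains_block w u"
    and occ: "is_occurrence (multi_pattern ws) v is'"
  shows "\<exists>is. is_occurrence (multi_pattern (w # ws)) (u @ v) is"
proof -
  let ?\<rho> = "multi_pattern (w # ws)" and ?\<rho>' = "multi_pattern ws"
  let ?L = "length w"
  let ?W = "word (multi_pattern ws)"
  obtain x y z where xyz: "u = x @ y @ z" and y: "matches_block w y"
    using u unfolding contains_block_def by blast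
  define "is" where "is = map ((+) (length x)) [0..<?L] @ map ((+) (length u)) is'"
  have leny: "length y = ?L" using y by (simp add: matches_block_def)
  have len': "length is' = length ?W" using occ by (simp add: is_occurrence_def)
  have len: "length is = ?L + length ?W" by (simp add: is_def len')
  have is1: "is ! p = length x + p" "(u @ v) ! (is ! p) = y ! p" if "p < ?L" for p
    using that leny by (simp_all add: is_def nth_append xyz)
  have is2: "is ! (?L + p) = length u + is' ! p" "(u @ v) ! (is ! (?L + p)) = v ! (is' ! p)"
    if "p < length ?W" for p
    using that len' by (simp_all add: is_def nth_append)
  have split: "p < ?L \<or> (\<exists>p'. p = ?L + p' \<and> p' < length ?W)" if "p < ?L + length ?W" for p
    using that by (cases "p < ?L") (auto intro!: exI[of _ "p - ?L"])
  have order_w: "(w ! p = w ! q \<longrightarrow> y ! p = y ! q) \<and> (w ! p < w ! q \<longrightarrow> y ! p < y ! q)"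
    if "p < ?L" "q < ?L" for p q
    using y that unfolding matches_block_def by blast
  have order_ws: "(?W ! p = ?W ! q \<longrightarrow> v ! (is' ! p) = v ! (is' ! q)) \<and>
      (prec ?\<rho>' (?W ! p) (?W ! q) \<longrightarrow> v ! (is' ! p) < v ! (is' ! q))"
    if "p < length ?W" "q < length ?W" for p q
    using occ that unfolding is_occurrence_def by blast
  have "is_occurrence ?\<rho> (u @ v) is"
    unfolding is_occurrence_def length_word_multi_pattern_Cons
  proof (intro conjI)
    show "length is = ?L + length ?W" by (fact len)
    have "sorted_wrt (<) is'" "\<forall>i\<in>set is'. i < length v"
      using occ by (simp_all add: is_occurrence_def)
    then show "sorted_wrt (<) is" "\<forall>i\<in>set is. i < length (u @ v)"
      using leny by (auto simp: is_def sorted_wrt_append sorted_wrt_map xyz)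
    show "\<forall>p. Suc p < ?L + length ?W \<and> p \<notin> dashes ?\<rho> \<longrightarrow> is ! Suc p = Suc (is ! p)"
    proof (intro allI impI)
      fix p assume p: "Suc p < ?L + length ?W \<and> p \<notin> dashes ?\<rho>"
      show "is ! Suc p = Suc (is ! p)"
      proof (cases "p < ?L")
        case True
        \<comment> \<open>The last letter of \<open>w\<close> is followed by a dash, unless \<open>w\<close> is the final block; then it is
            the last letter of the whole word.\<close>
        have "Suc p \<noteq> ?L"
          using p by (auto simp: dashes_multi_pattern_Cons[OF w] length_word_multi_pattern)
        then show ?thesis using True is1 by simp
      next
        case False
        then obtain p' where p': "p = ?L + p'" by (metis le_iff_add not_le)
        then have "Suc p' < length ?W" "p' \<notin> dashes ?\<rho>'"
          using p by (auto simp: dashes_multi_pattern_Cons[OF w])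
        then show ?thesis
          using occ is2(1)[of p'] is2(1)[of "Suc p'"] p' by (simp add: is_occurrence_def)
      qed
    qed
    show "\<forall>p < ?L + length ?W. \<forall>q < ?L + length ?W.
        (word ?\<rho> ! p = word ?\<rho> ! q \<longrightarrow> (u @ v) ! (is ! p) = (u @ v) ! (is ! q)) \<and>
        (prec ?\<rho> (word ?\<rho> ! p) (word ?\<rho> ! q) \<longrightarrow> (u @ v) ! (is ! p) < (u @ v) ! (is ! q))"
    proof (intro allI impI)
      fix p q assume pq: "p < ?L + length ?W" "q < ?L + length ?W"
      \<comment> \<open>Positions in different blocks carry unequal and incomparable letters.\<close>
      have mixed: "(0, i) \<noteq> map_prod Suc id k" "map_prod Suc id k \<noteq> (0, i)"
        "\<not> prec ?\<rho> (0, i) (map_prod Suc id k)" "\<not> prec ?\<rho> (map_prod Suc id k) (0, i)"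
        for i :: nat and k :: "nat \<times> nat"
        by (cases k; simp)+
      show "(word ?\<rho> ! p = word ?\<rho> ! q \<longrightarrow> (u @ v) ! (is ! p) = (u @ v) ! (is ! q)) \<and>
        (prec ?\<rho> (word ?\<rho> ! p) (word ?\<rho> ! q) \<longrightarrow> (u @ v) ! (is ! p) < (u @ v) ! (is ! q))"
        using split[OF pq(1)] split[OF pq(2)]
        by (elim disjE exE conjE;
            simp add: is1(2) is2(2) nth_word_multi_pattern_Cons prec_multi_pattern_Suc mixed;
            use order_w order_ws in blast)
    qed
  qed
  then show ?thesis by blast
qed

lemma ex_occurrence_iff:
  "[] \<notin> set ws \<Longrightarrow> (\<exists>is. is_occurrence (multi_pattern ws) \<sigma> is) \<longleftrightarrow> \<sigma> \<in> contains_blocks ws"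
proof (induction ws arbitrary: \<sigma>)
  case Nil
  have "is_occurrence (multi_pattern []) \<sigma> []"
    by (simp add: is_occurrence_def multi_pattern_def)
  then show ?case by auto
next
  case (Cons w ws)
  then have w: "w \<noteq> []" by auto
  have "(\<exists>is. is_occurrence (multi_pattern (w # ws)) \<sigma> is) \<longleftrightarrow>
      (\<exists>u v. \<sigma> = u @ v \<and> contains_block w u \<and> (\<exists>is'. is_occurrence (multi_pattern ws) v is'))"
    using is_occurrence_ConsD[OF w] is_occurrence_ConsI[OF w] by meson
  then show ?case
    using Cons by (auto simp: conc_def)
qed

section \<open>Counting compositions\<close>

lemma card_compositions_rearranges_to:
  assumes "rearranges_to X Y"
  shows "card (compositions A n m \<inter> X) = card (compositions A n m \<inter> Y)"
proof -
  from assms obtain f where f: "bij_betw f X Y" "\<forall>x\<in>X. mset (f x) = mset x"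
    unfolding rearranges_to_def by blast
  have "f x \<in> compositions A n m \<longleftrightarrow> x \<in> compositions A n m" if "x \<in> X" for x
    using f(2) that mset_eq_setD[of "f x" x] mset_eq_length[of "f x" x]
    by (simp add: compositions_def flip: sum_mset_sum_list)
  then have "f ` (compositions A n m \<inter> X) = compositions A n m \<inter> Y"
    using f(1) by (force simp: bij_betw_def)
  moreover have "inj_on f (compositions A n m \<inter> X)"
    using f(1) by (auto simp: bij_betw_def intro: inj_on_subset)
  ultimately show ?thesis
    by (metis card_image)
qed

lemma card_avoiding_multi_pattern:
  assumes "finite A" "[] \<notin> set ws"
  shows "card {\<sigma> \<in> compositions A n m. avoids \<sigma> (multi_pattern ws)} =
    card (compositions A n m) - card (compositions A n m \<inter> contains_blocks ws)"
proof -
  have "{\<sigma> \<in> compositions A n m. avoids \<sigma> (multi_pattern ws)} =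
      compositions A n m - compositions A n m \<inter> contains_blocks ws"
    using ex_occurrence_iff[OF assms(2)] by (auto simp: avoids_def)
  then show ?thesis
    by (simp add: card_Diff_subset finite_compositions assms(1))
qed

theorem theorem3p11:
  fixes \<tau>s \<phi>s :: "nat list list"
  assumes "\<forall>w\<in>set \<tau>s. consecutive_pattern w"
    and "\<forall>w\<in>set \<phi>s. consecutive_pattern w"
    and "\<tau>s <~~> \<phi>s"
  shows "pop_equiv (multi_pattern \<tau>s) (multi_pattern \<phi>s)"
proof -
  have "\<not> consecutive_pattern []" by (simp add: consecutive_pattern_def)
  then have "[] \<notin> set \<tau>s" "[] \<notin> set \<phi>s" using assms by auto
  moreover have "rearranges_to (contains_blocks \<tau>s) (contains_blocks \<phi>s)"
    using assms(3) by (rule rearranges_to_contains_blocks)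
  ultimately show ?thesis
    unfolding pop_equiv_def
    by (simp add: card_avoiding_multi_pattern card_compositions_rearranges_to)
qed

end
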